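(* Let $V$ be a Komori variety with associated invariant $n$, and let $A\in V$. Then the set $K(A)=\{x\in A\mid ((n+1)x)^2=0\}$ is an ideal of $A$ and it coincides with the radical $\mathrm{Rad}(A)$ of $A$.
   Context: An MV-algebra is a structure $(A,\oplus,\neg,0)$ such that $(A,\oplus,0)$ is a commutative monoid, $\neg\neg x=x$, $x\oplus\neg 0=\neg 0$ and $\neg(\neg x\oplus y)\oplus y=\neg(\neg y\oplus x)\oplus x$. Write $1=\neg 0$, $x\odot y=\neg(\neg x\oplus\neg y)$, $x\le y$ iff $\neg x\oplus y=1$, $kx=x\oplus\cdots\oplus x$ and $x^k=x\odot\cdots\odot x$ ($k$ times). An ideal is a $\le$-downset containing $0$ and closed under $\oplus$. The radical $\mathrm{Rad}(A)$ is (constructively) the set consisting of $0$ and of the infinitesimal elements of $A$, i.e. the elements $x\neq 0$ such that $kx\le\neg x$ for every $k\in\mathbb{N}$. For a lattice-ordered abelian group $G$ and $u\ge 0$ in $G$, $\Gamma(G,u)$ is the MV-algebra on $[0,u]$ with $x\oplus y=\inf(x+y,u)$, $\neg x=u-x$. For $m\ge 1$, $S_m=\Gamma(\mathbb{Z},m)$ and $S_m^\omega=\Gamma(\mathbb{Z}\times_{\mathrm{lex}}\mathbb{Z},(m,0))$. A Komori variety is a variety $V=V(\{S_i\}_{i\in I},\{S_j^\omega\}_{j\in J})$ generated by these algebras, with $I,J$ finite sets of positive integers, not both empty. Its invariant is $n=\mathrm{l.c.m.}(I\cup J)$, which depends only on $V$. *)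

theory Defs
  imports
    "HOL-Algebra.Congruence"
    "HOL-Library.Lattice_Algebras"
    "HOL-Library.Product_Lexorder"
    "HOL-Library.Product_Plus"
begin

section \<open>MV-algebras\<close>

record 'a mv = "'a partial_object" +
  mv_zero :: "'a" ("\<zero>\<index>")
  mv_neg :: "'a \<Rightarrow> 'a" ("\<sim>\<index> _" [81] 80)
  mv_plus :: "'a \<Rightarrow> 'a \<Rightarrow> 'a" (infixl "\<oplus>\<index>" 65)

locale mv_algebra =
  fixes A :: "('a, 'm) mv_scheme" (structure)
  assumes zero_closed [simp, intro]: "\<zero> \<in> carrier A"
    and neg_closed [simp, intro]: "x \<in> carrier A \<Longrightarrow> \<sim> x \<in> carrier A"
    and plus_closed [simp, intro]: "\<lbrakk>x \<in> carrier A; y \<in> carrier A\<rbrakk> \<Longrightarrow> x \<oplus> y \<in> carrier A"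
    and plus_assoc: "\<lbrakk>x \<in> carrier A; y \<in> carrier A; z \<in> carrier A\<rbrakk>
          \<Longrightarrow> (x \<oplus> y) \<oplus> z = x \<oplus> (y \<oplus> z)"
    and plus_comm: "\<lbrakk>x \<in> carrier A; y \<in> carrier A\<rbrakk> \<Longrightarrow> x \<oplus> y = y \<oplus> x"
    and plus_zero: "x \<in> carrier A \<Longrightarrow> x \<oplus> \<zero> = x"
    and neg_neg: "x \<in> carrier A \<Longrightarrow> \<sim> (\<sim> x) = x"
    and plus_neg_zero: "x \<in> carrier A \<Longrightarrow> x \<oplus> \<sim> \<zero> = \<sim> \<zero>"
    and lukasiewicz: "\<lbrakk>x \<in> carrier A; y \<in> carrier A\<rbrakk>
          \<Longrightarrow> \<sim> (\<sim> x \<oplus> y) \<oplus> y = \<sim> (\<sim> y \<oplus> x) \<oplus> x"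

definition mv_one :: "('a, 'm) mv_scheme \<Rightarrow> 'a" ("\<one>\<index>") where
  "\<one>\<^bsub>A\<^esub> = \<sim>\<^bsub>A\<^esub> \<zero>\<^bsub>A\<^esub>"

definition mv_mult :: "('a, 'm) mv_scheme \<Rightarrow> 'a \<Rightarrow> 'a \<Rightarrow> 'a" (infixl "\<odot>\<index>" 70) where
  "x \<odot>\<^bsub>A\<^esub> y = \<sim>\<^bsub>A\<^esub> (\<sim>\<^bsub>A\<^esub> x \<oplus>\<^bsub>A\<^esub> \<sim>\<^bsub>A\<^esub> y)"

definition mv_le :: "('a, 'm) mv_scheme \<Rightarrow> 'a \<Rightarrow> 'a \<Rightarrow> bool" (infix "\<preceq>\<index>" 50) where
  "x \<preceq>\<^bsub>A\<^esub> y \<longleftrightarrow> \<sim>\<^bsub>A\<^esub> x \<oplus>\<^bsub>A\<^esub> y = \<one>\<^bsub>A\<^esub>"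

primrec mv_nmul :: "('a, 'm) mv_scheme \<Rightarrow> nat \<Rightarrow> 'a \<Rightarrow> 'a" where
  "mv_nmul A 0 x = \<zero>\<^bsub>A\<^esub>"
| "mv_nmul A (Suc k) x = mv_nmul A k x \<oplus>\<^bsub>A\<^esub> x"

primrec mv_npow :: "('a, 'm) mv_scheme \<Rightarrow> nat \<Rightarrow> 'a \<Rightarrow> 'a" where
  "mv_npow A 0 x = \<one>\<^bsub>A\<^esub>"
| "mv_npow A (Suc k) x = mv_npow A k x \<odot>\<^bsub>A\<^esub> x"

definition mv_ideal :: "('a, 'm) mv_scheme \<Rightarrow> 'a set \<Rightarrow> bool" where
  "mv_ideal A S \<longleftrightarrow>
     S \<subseteq> carrier A \<and>
     \<zero>\<^bsub>A\<^esub> \<in> S \<and>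
     (\<forall>x\<in>carrier A. \<forall>y\<in>S. x \<preceq>\<^bsub>A\<^esub> y \<longrightarrow> x \<in> S) \<and>
     (\<forall>x\<in>S. \<forall>y\<in>S. x \<oplus>\<^bsub>A\<^esub> y \<in> S)"

definition mv_infinitesimal :: "('a, 'm) mv_scheme \<Rightarrow> 'a \<Rightarrow> bool" where
  "mv_infinitesimal A x \<longleftrightarrow>
     x \<in> carrier A \<and> x \<noteq> \<zero>\<^bsub>A\<^esub> \<and> (\<forall>k. mv_nmul A k x \<preceq>\<^bsub>A\<^esub> \<sim>\<^bsub>A\<^esub> x)"

text \<open>The constructive description of the radical, not the intersection of the maximal ideals.\<close>

definition mv_Rad :: "('a, 'm) mv_scheme \<Rightarrow> 'a set" where
  "mv_Rad A = {\<zero>\<^bsub>A\<^esub>} \<union> {x. mv_infinitesimal A x}"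


section \<open>Varieties of MV-algebras\<close>

datatype mv_term = Var nat | Zero | Neg mv_term | Plus mv_term mv_term

type_synonym mv_identity = "mv_term \<times> mv_term"

primrec mv_eval :: "('a, 'm) mv_scheme \<Rightarrow> (nat \<Rightarrow> 'a) \<Rightarrow> mv_term \<Rightarrow> 'a" where
  "mv_eval A \<rho> (Var i) = \<rho> i"
| "mv_eval A \<rho> Zero = \<zero>\<^bsub>A\<^esub>"
| "mv_eval A \<rho> (Neg t) = \<sim>\<^bsub>A\<^esub> (mv_eval A \<rho> t)"
| "mv_eval A \<rho> (Plus s t) = mv_eval A \<rho> s \<oplus>\<^bsub>A\<^esub> mv_eval A \<rho> t"

definition mv_satisfies :: "('a, 'm) mv_scheme \<Rightarrow> mv_identity \<Rightarrow> bool" where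
  "mv_satisfies A e \<longleftrightarrow>
     (\<forall>\<rho>. (\<forall>i. \<rho> i \<in> carrier A) \<longrightarrow> mv_eval A \<rho> (fst e) = mv_eval A \<rho> (snd e))"

text \<open>
  A variety is a class of MV-algebras over arbitrary types, so it is represented by a defining set
  \<open>E\<close> of identities; \<open>in_variety E A\<close> says that \<open>A\<close> belongs to it.
\<close>

definition in_variety :: "mv_identity set \<Rightarrow> ('a, 'm) mv_scheme \<Rightarrow> bool" where
  "in_variety E A \<longleftrightarrow> mv_algebra A \<and> (\<forall>e\<in>E. mv_satisfies A e)"


section \<open>The MV-algebras of lattice-ordered abelian groups with a distinguished element\<close>

definition mv_Gamma :: "'g::lattice_ab_group_add \<Rightarrow> 'g mv" where
  "mv_Gamma u = \<lparr>carrier = {0..u}, mv_zero = 0, mv_neg = (\<lambda>x. u - x),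
                 mv_plus = (\<lambda>x y. inf (x + y) u)\<rparr>"

lemma mv_algebra_Gamma:
  fixes u :: "'g::lattice_ab_group_add"
  assumes "0 \<le> u"
  shows "mv_algebra (mv_Gamma u)"
proof -
  have assoc: "inf (inf (x + y) u + z) u = inf (x + inf (y + z) u) u"
    if "0 \<le> x" "0 \<le> z" for x y z :: 'g
  proof -
    have "u \<le> u + z" "u \<le> x + u" using that by simp_all
    then have "inf (u + z) u = u" "inf (x + u) u = u" by (simp_all add: inf_absorb2)
    then show ?thesis
      by (simp only: add_inf_distrib_left add_inf_distrib_right inf_assoc add.assoc)
  qed
  have luk: "inf (u - inf (u - x + y) u + y) u = sup x y"
    if "x \<le> u" "y \<le> u" for x y :: 'g
  proof -
    have "u - inf (u - x + y) u = sup (x - y) 0"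
      by (simp only: diff_conv_add_uminus neg_inf_eq_sup add_sup_distrib_left) simp
    then have "u - inf (u - x + y) u + y = sup x y"
      by (simp add: add_sup_distrib_right)
    then show ?thesis using that by (simp add: inf_absorb1)
  qed
  show ?thesis
  proof
    fix x y z
    assume "x \<in> carrier (mv_Gamma u)" "y \<in> carrier (mv_Gamma u)" "z \<in> carrier (mv_Gamma u)"
    then show "x \<oplus>\<^bsub>mv_Gamma u\<^esub> y \<oplus>\<^bsub>mv_Gamma u\<^esub> z = x \<oplus>\<^bsub>mv_Gamma u\<^esub> (y \<oplus>\<^bsub>mv_Gamma u\<^esub> z)"
      by (simp add: mv_Gamma_def assoc)
  next
    fix x y
    assume "x \<in> carrier (mv_Gamma u)" "y \<in> carrier (mv_Gamma u)"
    then have "x \<le> u" "y \<le> u" by (simp_all add: mv_Gamma_def)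
    then show "\<sim>\<^bsub>mv_Gamma u\<^esub> (\<sim>\<^bsub>mv_Gamma u\<^esub> x \<oplus>\<^bsub>mv_Gamma u\<^esub> y) \<oplus>\<^bsub>mv_Gamma u\<^esub> y
        = \<sim>\<^bsub>mv_Gamma u\<^esub> (\<sim>\<^bsub>mv_Gamma u\<^esub> y \<oplus>\<^bsub>mv_Gamma u\<^esub> x) \<oplus>\<^bsub>mv_Gamma u\<^esub> x"
      using luk[of x y] luk[of y x] by (simp add: mv_Gamma_def sup_commute)
  qed (use assms in \<open>simp_all add: mv_Gamma_def inf_absorb1 inf_absorb2 add.commute\<close>)
qed

text \<open>With \<open>Product_Lexorder\<close> in scope the order on pairs is lexicographic.\<close>

instance prod :: (linordered_ab_group_add, linordered_ab_group_add) ordered_ab_group_add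
  by standard (auto simp: less_eq_prod_def)

instance prod :: (linordered_ab_group_add, linordered_ab_group_add) lattice_ab_group_add ..

definition S_alg :: "nat \<Rightarrow> int mv" where
  "S_alg m = mv_Gamma (int m)"

definition S_omega_alg :: "nat \<Rightarrow> (int \<times> int) mv" where
  "S_omega_alg m = mv_Gamma (int m, 0)"


section \<open>Komori varieties\<close>

definition komori_data :: "nat set \<Rightarrow> nat set \<Rightarrow> bool" where
  "komori_data I J \<longleftrightarrow>
     finite I \<and> finite J \<and> (\<forall>i\<in>I. 1 \<le> i) \<and> (\<forall>j\<in>J. 1 \<le> j) \<and> I \<union> J \<noteq> {}"

text \<open>
  Membership in the smallest variety containing the generators.  It is stated pointwise, as
  membership in every variety that contains them, because the generators and \<open>A\<close> have different
  types.
\<close>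

definition in_komori_variety :: "nat set \<Rightarrow> nat set \<Rightarrow> ('a, 'm) mv_scheme \<Rightarrow> bool" where
  "in_komori_variety I J A \<longleftrightarrow>
     (\<forall>E. (\<forall>i\<in>I. in_variety E (S_alg i)) \<and> (\<forall>j\<in>J. in_variety E (S_omega_alg j))
        \<longrightarrow> in_variety E A)"

definition komori_invariant :: "nat set \<Rightarrow> nat set \<Rightarrow> nat" where
  "komori_invariant I J = Lcm (I \<union> J)"

definition mv_K :: "nat \<Rightarrow> ('a, 'm) mv_scheme \<Rightarrow> 'a set" where
  "mv_K n A = {x \<in> carrier A. mv_npow A 2 (mv_nmul A (n + 1) x) = \<zero>\<^bsub>A\<^esub>}"

end

theory Submission
  imports Defs
begin

text \<open>
  Write \<open>t x = ((n+1)x)\<^sup>2\<close>.  Each generator of the variety is a chain on which \<open>t\<close> takes only the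
  values \<open>0\<close> and \<open>1\<close>: it is \<open>0\<close> on the ideal \<open>Q\<close> of infinitely small elements (only \<open>0\<close> in \<open>S_i\<close>, the
  elements with first component \<open>0\<close> in \<open>S_j^\<omega>\<close>), and outside \<open>Q\<close> already \<open>(n+1)x = 1\<close>, because
  the integer part of \<open>x\<close> is at least \<open>1\<close> and that of the unit, a divisor of \<open>n\<close>, is at most \<open>n\<close>.  The locale
  \<open>mv_gap\<close> records this situation and \<open>mv_gap_Gamma\<close> establishes it for all generators at once.

  The following equations hold in every algebra with such a gap, hence in the whole variety:
  \<^item> \<open>t (x \<oplus> y) = t x \<oplus> t y\<close>, so that the zero set of \<open>t\<close> is closed under sums, and
    also under passing to smaller elements, because \<open>x \<le> y\<close> makes \<open>x\<close> a summand of \<open>y\<close>;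
  \<^item> \<open>(\<sim>(kx) \<oplus> \<sim>x) \<oplus> t x = 1\<close> for each \<open>k\<close>, so that \<open>t x = 0\<close> forces \<open>kx \<le> \<sim>x\<close>;
  \<^item> \<open>t x \<oplus> w x = w x\<close> where \<open>w x = (n+1)((n+1)x \<odot> x)\<close>.  If \<open>(n+1)x \<le> \<sim>x\<close> then \<open>w x = 0\<close>, so
    that infinitesimals are zeros of \<open>t\<close>.

  Expressing the inclusions between zero sets by equations is what allows them to pass from the
  generators, where they are proved by a case distinction on membership in \<open>Q\<close>, to all members of
  the variety, which have no such distinction.
\<close>

section \<open>Elementary arithmetic of MV-algebras\<close>

context mv_algebra
begin

lemma one_closed [simp, intro]: "\<one> \<in> carrier A"
  by (simp add: mv_one_def)

lemma mult_closed [simp, intro]: "\<lbrakk>x \<in> carrier A; y \<in> carrier A\<rbrakk> \<Longrightarrow> x \<odot> y \<in> carrier A"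
  by (simp add: mv_mult_def)

lemma nmul_closed [simp, intro]: "x \<in> carrier A \<Longrightarrow> mv_nmul A k x \<in> carrier A"
  by (induction k) auto

lemma zero_plus: "x \<in> carrier A \<Longrightarrow> \<zero> \<oplus> x = x"
  using plus_comm[of x "\<zero>"] plus_zero[of x] by simp

lemma plus_one: "x \<in> carrier A \<Longrightarrow> x \<oplus> \<one> = \<one>"
  by (simp add: mv_one_def plus_neg_zero)

lemma one_plus: "x \<in> carrier A \<Longrightarrow> \<one> \<oplus> x = \<one>"
  using plus_comm[of x "\<one>"] plus_one[of x] by simp

lemma neg_one: "\<sim> \<one> = \<zero>"
  by (simp add: mv_one_def neg_neg)

lemma neg_zero: "\<sim> \<zero> = \<one>"
  by (simp add: mv_one_def)

lemma neg_plus_self: "x \<in> carrier A \<Longrightarrow> \<sim> x \<oplus> x = \<one>"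
  using lukasiewicz[of "\<one>" x] by (simp add: neg_one zero_plus plus_one)

lemma one_mult: "x \<in> carrier A \<Longrightarrow> \<one> \<odot> x = x"
  by (simp add: mv_mult_def neg_one zero_plus neg_neg)

lemma zero_mult: "x \<in> carrier A \<Longrightarrow> \<zero> \<odot> x = \<zero>"
  by (simp add: mv_mult_def neg_zero one_plus neg_one)

lemma nmul_zero: "mv_nmul A k \<zero> = \<zero>"
  by (induction k) (auto simp: plus_zero)

lemma npow_two: "x \<in> carrier A \<Longrightarrow> mv_npow A 2 x = x \<odot> x"
  by (simp add: numeral_2_eq_2 one_mult)

lemma le_plus: "\<lbrakk>x \<in> carrier A; y \<in> carrier A\<rbrakk> \<Longrightarrow> x \<preceq> x \<oplus> y"
  by (simp add: mv_le_def plus_assoc[symmetric] neg_plus_self one_plus)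

lemma plus_eq_zeroD:
  assumes "x \<in> carrier A" "y \<in> carrier A" "x \<oplus> y = \<zero>"
  shows "x = \<zero>"
proof -
  have "\<sim> x = \<one>"
    using le_plus[of x y] assms by (simp add: mv_le_def plus_zero)
  then show ?thesis using neg_neg[of x] assms by (simp add: neg_one)
qed

lemma le_imp_eq_plus:
  assumes "x \<in> carrier A" "y \<in> carrier A" "x \<preceq> y"
  shows "y = x \<oplus> \<sim> (\<sim> y \<oplus> x)"
proof -
  have "\<sim> (\<sim> x \<oplus> y) \<oplus> y = y"
    using assms by (simp add: mv_le_def neg_one zero_plus)
  then show ?thesis
    using lukasiewicz[of x y] assms plus_comm[of x "\<sim> (\<sim> y \<oplus> x)"] by simp
qed

end


section \<open>MV-algebras with a gap above their infinitely small elements\<close>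

definition mv_threshold :: "nat \<Rightarrow> ('a, 'm) mv_scheme \<Rightarrow> 'a \<Rightarrow> 'a" where
  "mv_threshold n A x = mv_npow A 2 (mv_nmul A (n + 1) x)"

lemma (in mv_algebra) threshold_closed [simp, intro]:
  "x \<in> carrier A \<Longrightarrow> mv_threshold n A x \<in> carrier A"
  by (simp add: mv_threshold_def npow_two del: mv_nmul.simps)

lemma (in mv_algebra) threshold_zero: "mv_threshold n A \<zero> = \<zero>"
  by (simp add: mv_threshold_def nmul_zero npow_two zero_mult del: mv_nmul.simps)

locale mv_gap = mv_algebra A for A :: "('a, 'm) mv_scheme" (structure) +
  fixes n :: nat and Q :: "'a set"
  assumes ideal: "mv_ideal A Q"
    and small_mult: "\<lbrakk>x \<in> Q; y \<in> Q\<rbrakk> \<Longrightarrow> x \<odot> y = \<zero>"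
    and large_nmul: "\<lbrakk>x \<in> carrier A; x \<notin> Q\<rbrakk> \<Longrightarrow> mv_nmul A (n + 1) x = \<one>"
begin

lemma small_nmul: "x \<in> Q \<Longrightarrow> mv_nmul A k x \<in> Q"
  using ideal by (induction k) (auto simp: mv_ideal_def)

lemma small_carrier: "x \<in> Q \<Longrightarrow> x \<in> carrier A"
  using ideal by (auto simp: mv_ideal_def)

lemma threshold_small: "x \<in> Q \<Longrightarrow> mv_threshold n A x = \<zero>"
  using small_mult[OF small_nmul small_nmul, of x x "n + 1" "n + 1"]
  by (simp add: mv_threshold_def npow_two small_carrier del: mv_nmul.simps)

lemma threshold_large: "\<lbrakk>x \<in> carrier A; x \<notin> Q\<rbrakk> \<Longrightarrow> mv_threshold n A x = \<one>"
  using large_nmul[of x] by (simp add: mv_threshold_def npow_two one_mult del: mv_nmul.simps)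

lemma small_plus_iff:
  assumes "x \<in> carrier A" "y \<in> carrier A"
  shows "x \<oplus> y \<in> Q \<longleftrightarrow> x \<in> Q \<and> y \<in> Q"
proof -
  have "x \<preceq> x \<oplus> y" "y \<preceq> x \<oplus> y"
    using le_plus[of x y] le_plus[of y x] plus_comm assms by auto
  then show ?thesis using ideal assms unfolding mv_ideal_def by blast
qed

lemma threshold_plus:
  assumes "x \<in> carrier A" "y \<in> carrier A"
  shows "mv_threshold n A (x \<oplus> y) = mv_threshold n A x \<oplus> mv_threshold n A y"
  using small_plus_iff[OF assms] assms
  by (cases "x \<in> Q"; cases "y \<in> Q")
     (simp_all add: threshold_small threshold_large plus_zero zero_plus plus_one one_plus)

lemma nmul_le_neg_or_threshold:
  assumes "x \<in> carrier A"
  shows "(\<sim> (mv_nmul A k x) \<oplus> \<sim> x) \<oplus> mv_threshold n A x = \<one>"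
proof (cases "x \<in> Q")
  case True
  have "\<sim> (mv_nmul A k x \<odot> x) = \<sim> (mv_nmul A k x) \<oplus> \<sim> x"
    using assms by (simp add: mv_mult_def neg_neg)
  then show ?thesis
    using True assms small_mult[OF small_nmul[OF True] True, of k]
    by (simp add: threshold_small plus_zero neg_zero)
qed (use assms in \<open>simp add: threshold_large plus_one\<close>)

text \<open>
  The outer multiple is there because outside \<open>Q\<close> the element \<open>(n+1)x \<odot> x\<close> is only \<open>x\<close>, which need
  not dominate \<open>1\<close>.
\<close>

lemma threshold_plus_nmul:
  fixes x
  defines "w \<equiv> mv_nmul A (n + 1) (mv_nmul A (n + 1) x \<odot> x)"
  assumes "x \<in> carrier A"
  shows "mv_threshold n A x \<oplus> w = w"
proof (cases "x \<in> Q")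
  case True
  then show ?thesis
    using assms by (simp add: threshold_small zero_plus del: mv_nmul.simps)
next
  case False
  then have "w = \<one>"
    using assms large_nmul[of x] by (simp add: one_mult del: mv_nmul.simps)
  then show ?thesis using assms by (simp add: plus_one)
qed

end


section \<open>The generators have a gap\<close>

text \<open>
  The map \<open>f\<close> is the integer part: the identity on \<open>\<int>\<close> and the first projection on
  \<open>\<int> \<times>\<^sub>l\<^sub>e\<^sub>x \<int>\<close>.  The linearity of the order is a hypothesis since the construction \<open>mv_Gamma\<close> asks
  for a lattice-ordered group.
\<close>

lemma mv_gap_Gamma:
  fixes u :: "'g::lattice_ab_group_add" and f :: "'g \<Rightarrow> int"
  assumes total: "\<And>x y :: 'g. x \<le> y \<or> y \<le> x"
    and add: "\<And>x y. f (x + y) = f x + f y"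
    and mono: "\<And>x y. x \<le> y \<Longrightarrow> f x \<le> f y"
    and u: "0 < f u" "f u \<le> int n"
  shows "mv_gap (mv_Gamma u) n {x \<in> {0..u}. f x = 0}"
proof -
  let ?M = "mv_Gamma u" and ?Q = "{x \<in> {0..u}. f x = 0}"
  have f0: "f 0 = 0" using add[of 0 0] by simp
  have less: "x \<le> y" if "f x < f y" for x y
    using total[of x y] mono[of y x] that by auto
  have u0: "0 \<le> u" using less[of 0 u] u f0 by simp
  interpret mv_algebra ?M by (rule mv_algebra_Gamma[OF u0])
  have one: "\<one>\<^bsub>?M\<^esub> = u" by (simp add: mv_one_def mv_Gamma_def)
  have le: "x \<le> y" if "x \<preceq>\<^bsub>?M\<^esub> y" for x y
  proof -
    have "inf (u - x + y) u = u" using that one by (simp add: mv_le_def mv_Gamma_def)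
    then have "u \<le> u - x + y" by (simp add: le_iff_inf inf_commute)
    then show ?thesis by (simp add: algebra_simps)
  qed
  show ?thesis
  proof
    show "mv_ideal ?M ?Q"
      unfolding mv_ideal_def
    proof (intro conjI ballI impI)
      show "?Q \<subseteq> carrier ?M" by (auto simp: mv_Gamma_def)
      show "\<zero>\<^bsub>?M\<^esub> \<in> ?Q" using u0 f0 by (simp add: mv_Gamma_def)
    next
      fix x y assume "x \<in> carrier ?M" "y \<in> ?Q" "x \<preceq>\<^bsub>?M\<^esub> y"
      then show "x \<in> ?Q"
        using le[of x y] mono[of x y] mono[of 0 x] f0 by (auto simp: mv_Gamma_def)
    next
      fix x y assume xy: "x \<in> ?Q" "y \<in> ?Q"
      have "x + y \<le> u" using less[of "x + y" u] u xy add by simp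
      then show "x \<oplus>\<^bsub>?M\<^esub> y \<in> ?Q" using xy add by (simp add: mv_Gamma_def inf_absorb1)
    qed
  next
    fix x y assume xy: "x \<in> ?Q" "y \<in> ?Q"
    have "x + y \<le> u" using less[of "x + y" u] u xy add by simp
    then have "u \<le> u - x + (u - y)" by (simp add: algebra_simps)
    then show "x \<odot>\<^bsub>?M\<^esub> y = \<zero>\<^bsub>?M\<^esub>"
      by (simp add: mv_mult_def mv_Gamma_def inf_absorb2)
  next
    fix x assume x: "x \<in> carrier ?M" "x \<notin> ?Q"
    then have x0: "0 \<le> x" and fx: "1 \<le> f x"
      using mono[of 0 x] f0 by (auto simp: mv_Gamma_def)
    \<comment> \<open>Each further summand raises the integer part by at least \<open>1\<close> until the sum is truncated at \<open>u\<close>.\<close>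
    have grow: "mv_nmul ?M k x = u \<or> int k \<le> f (mv_nmul ?M k x)" for k
    proof (induction k)
      case 0
      show ?case using f0 by (simp add: mv_Gamma_def)
    next
      case (Suc k)
      let ?y = "mv_nmul ?M k x"
      have step: "mv_nmul ?M (Suc k) x = inf (?y + x) u" by (simp add: mv_Gamma_def)
      show ?case
      proof (cases "u \<le> ?y + x")
        case True
        then show ?thesis by (simp only: step inf_absorb2) simp
      next
        case False
        then have "?y \<noteq> u" using x0 by auto
        then have "int (Suc k) \<le> f (?y + x)" using Suc fx add[of ?y x] by simp
        moreover have "?y + x \<le> u" using total False by blast
        ultimately show ?thesis by (simp only: step inf_absorb1) simp
      qed
    qed
    have "mv_nmul ?M (n + 1) x \<in> carrier ?M" using x nmul_closed by blast
    then have "f (mv_nmul ?M (n + 1) x) \<le> int n"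
      using mono[of "mv_nmul ?M (n + 1) x" u] u by (simp add: mv_Gamma_def)
    then show "mv_nmul ?M (n + 1) x = \<one>\<^bsub>?M\<^esub>"
      using grow[of "n + 1"] one by simp
  qed
qed

lemma mv_gap_S_alg:
  assumes "1 \<le> m" "m \<le> n"
  shows "\<exists>Q. mv_gap (S_alg m) n Q"
  unfolding S_alg_def
  by (rule exI, rule mv_gap_Gamma[where f = "\<lambda>x. x"]) (use assms in auto)

lemma mv_gap_S_omega_alg:
  assumes "1 \<le> m" "m \<le> n"
  shows "\<exists>Q. mv_gap (S_omega_alg m) n Q"
  unfolding S_omega_alg_def
  by (rule exI, rule mv_gap_Gamma[where f = fst]) (use assms in \<open>auto simp: less_eq_prod_def\<close>)


section \<open>Transfer of equations from the generators\<close>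

lemma in_komori_variety_mv_algebra:
  assumes "in_komori_variety I J A"
  shows "mv_algebra A"
proof -
  have "in_variety {} (S_alg i)" for i
    using mv_algebra_Gamma[of "int i"] by (simp add: in_variety_def S_alg_def)
  moreover have "in_variety {} (S_omega_alg j)" for j
    using mv_algebra_Gamma[of "(int j, 0)"]
    by (simp add: in_variety_def S_omega_alg_def zero_prod_def)
  ultimately have "in_variety {} A"
    using assms unfolding in_komori_variety_def by blast
  then show ?thesis by (simp add: in_variety_def)
qed

lemma in_komori_variety_satisfies:
  assumes "in_komori_variety I J A"
    and "\<And>i. i \<in> I \<Longrightarrow> mv_algebra (S_alg i) \<and> mv_satisfies (S_alg i) e"
    and "\<And>j. j \<in> J \<Longrightarrow> mv_algebra (S_omega_alg j) \<and> mv_satisfies (S_omega_alg j) e"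
  shows "mv_satisfies A e"
proof -
  have "in_variety {e} A"
    using assms unfolding in_komori_variety_def in_variety_def by blast
  then show ?thesis by (simp add: in_variety_def)
qed

lemma mv_satisfiesD:
  assumes "mv_satisfies A e" "\<And>i. \<rho> i \<in> carrier A"
  shows "mv_eval A \<rho> (fst e) = mv_eval A \<rho> (snd e)"
  using assms by (simp add: mv_satisfies_def)

text \<open>
  In the algebra of terms the derived operations of MV-algebras are themselves terms, so that the
  equations can be written with them instead of being unfolded.
\<close>

definition term_alg :: "mv_term mv" where
  "term_alg = \<lparr>carrier = UNIV, mv_zero = Zero, mv_neg = Neg, mv_plus = Plus\<rparr>"

lemma eval_plus [simp]: "mv_eval A \<rho> (s \<oplus>\<^bsub>term_alg\<^esub> t) = mv_eval A \<rho> s \<oplus>\<^bsub>A\<^esub> mv_eval A \<rho> t"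
  by (simp add: term_alg_def)

lemma eval_neg [simp]: "mv_eval A \<rho> (\<sim>\<^bsub>term_alg\<^esub> t) = \<sim>\<^bsub>A\<^esub> (mv_eval A \<rho> t)"
  by (simp add: term_alg_def)

lemma eval_zero [simp]: "mv_eval A \<rho> \<zero>\<^bsub>term_alg\<^esub> = \<zero>\<^bsub>A\<^esub>"
  by (simp add: term_alg_def)

lemma eval_one [simp]: "mv_eval A \<rho> \<one>\<^bsub>term_alg\<^esub> = \<one>\<^bsub>A\<^esub>"
  by (simp add: mv_one_def)

lemma eval_mult [simp]: "mv_eval A \<rho> (s \<odot>\<^bsub>term_alg\<^esub> t) = mv_eval A \<rho> s \<odot>\<^bsub>A\<^esub> mv_eval A \<rho> t"
  by (simp add: mv_mult_def)

lemma eval_nmul: "mv_eval A \<rho> (mv_nmul term_alg k t) = mv_nmul A k (mv_eval A \<rho> t)"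
  by (induction k) simp_all

lemma eval_npow: "mv_eval A \<rho> (mv_npow term_alg k t) = mv_npow A k (mv_eval A \<rho> t)"
  by (induction k) simp_all

lemma eval_threshold:
  "mv_eval A \<rho> (mv_threshold n term_alg t) = mv_threshold n A (mv_eval A \<rho> t)"
  by (simp add: mv_threshold_def eval_npow eval_nmul del: mv_nmul.simps)

lemmas eval_simps = eval_nmul eval_npow eval_threshold

lemma komori_generator_le:
  assumes "komori_data I J" "m \<in> I \<union> J"
  shows "1 \<le> m" "m \<le> komori_invariant I J"
proof -
  show "1 \<le> m" using assms by (auto simp: komori_data_def)
  have "finite (I \<union> J)" "0 \<notin> I \<union> J" using assms by (auto simp: komori_data_def)
  then have "komori_invariant I J \<noteq> 0"
    by (simp add: komori_invariant_def Lcm_0_iff)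
  moreover have "m dvd komori_invariant I J"
    using assms by (simp add: komori_invariant_def dvd_Lcm)
  ultimately show "m \<le> komori_invariant I J" by (simp add: dvd_imp_le)
qed

text \<open>
  The identity is required only of gap algebras over \<open>int\<close> and \<open>int \<times> int\<close>, since a hypothesis
  cannot range over types.
\<close>

lemma komori_satisfiesI:
  assumes "komori_data I J" "n = komori_invariant I J" "in_komori_variety I J A"
    and "\<And>(M :: int mv) Q. mv_gap M n Q \<Longrightarrow> mv_satisfies M e"
    and "\<And>(M :: (int \<times> int) mv) Q. mv_gap M n Q \<Longrightarrow> mv_satisfies M e"
  shows "mv_satisfies A e"
proof (rule in_komori_variety_satisfies[OF assms(3)])
  fix i assume "i \<in> I"
  then obtain Q where "mv_gap (S_alg i) n Q"
    using mv_gap_S_alg komori_generator_le[OF assms(1), of i] assms(2) by auto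
  then show "mv_algebra (S_alg i) \<and> mv_satisfies (S_alg i) e"
    using assms(4) mv_gap.axioms(1) by blast
next
  fix j assume "j \<in> J"
  then obtain Q where "mv_gap (S_omega_alg j) n Q"
    using mv_gap_S_omega_alg komori_generator_le[OF assms(1), of j] assms(2) by auto
  then show "mv_algebra (S_omega_alg j) \<and> mv_satisfies (S_omega_alg j) e"
    using assms(5) mv_gap.axioms(1) by blast
qed

context
  fixes I J :: "nat set" and n :: nat and A :: "'a mv" (structure)
  assumes komori: "komori_data I J" "n = komori_invariant I J" "in_komori_variety I J A"
begin

lemma komori_threshold_plus:
  assumes "x \<in> carrier A" "y \<in> carrier A"
  shows "mv_threshold n A (x \<oplus> y) = mv_threshold n A x \<oplus> mv_threshold n A y"
proof -
  let ?t = "mv_threshold n term_alg"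
  let ?e = "(?t (Var 0 \<oplus>\<^bsub>term_alg\<^esub> Var 1), ?t (Var 0) \<oplus>\<^bsub>term_alg\<^esub> ?t (Var 1))"
  have "mv_satisfies A ?e"
    by (rule komori_satisfiesI[OF komori])
       (simp_all add: mv_satisfies_def eval_simps mv_gap.threshold_plus)
  then have "mv_eval A (\<lambda>i. if i = 0 then x else y) (fst ?e)
      = mv_eval A (\<lambda>i. if i = 0 then x else y) (snd ?e)"
    by (rule mv_satisfiesD) (simp add: assms)
  then show ?thesis by (simp add: eval_simps)
qed

lemma komori_nmul_le_neg_or_threshold:
  assumes "x \<in> carrier A"
  shows "(\<sim> (mv_nmul A k x) \<oplus> \<sim> x) \<oplus> mv_threshold n A x = \<one>"
proof -
  let ?T = "term_alg"
  let ?e = "((\<sim>\<^bsub>?T\<^esub> (mv_nmul ?T k (Var 0)) \<oplus>\<^bsub>?T\<^esub> \<sim>\<^bsub>?T\<^esub> (Var 0)) \<oplus>\<^bsub>?T\<^esub> mv_threshold n ?T (Var 0),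
             \<one>\<^bsub>?T\<^esub>)"
  have "mv_satisfies A ?e"
    by (rule komori_satisfiesI[OF komori])
       (simp_all add: mv_satisfies_def eval_simps mv_gap.nmul_le_neg_or_threshold)
  then have "mv_eval A (\<lambda>_. x) (fst ?e) = mv_eval A (\<lambda>_. x) (snd ?e)"
    by (rule mv_satisfiesD) (simp add: assms)
  then show ?thesis by (simp add: eval_simps)
qed

lemma komori_threshold_plus_nmul:
  fixes x
  defines "w \<equiv> mv_nmul A (n + 1) (mv_nmul A (n + 1) x \<odot> x)"
  assumes "x \<in> carrier A"
  shows "mv_threshold n A x \<oplus> w = w"
proof -
  let ?T = "term_alg"
  let ?w = "mv_nmul ?T (n + 1) (mv_nmul ?T (n + 1) (Var 0) \<odot>\<^bsub>?T\<^esub> Var 0)"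
  let ?e = "(mv_threshold n ?T (Var 0) \<oplus>\<^bsub>?T\<^esub> ?w, ?w)"
  have "mv_satisfies A ?e"
    by (rule komori_satisfiesI[OF komori])
       (simp_all add: mv_satisfies_def eval_simps mv_gap.threshold_plus_nmul
         del: mv_nmul.simps One_nat_def)
  then have "mv_eval A (\<lambda>_. x) (fst ?e) = mv_eval A (\<lambda>_. x) (snd ?e)"
    by (rule mv_satisfiesD) (simp add: assms)
  then show ?thesis by (simp add: w_def eval_simps del: mv_nmul.simps One_nat_def)
qed

end


section \<open>The zero set of the threshold is the radical\<close>

theorem lemma5p8:
  fixes I J :: "nat set" and n :: nat and A :: "'a mv"
  assumes "komori_data I J"
    and "n = komori_invariant I J"
    and "in_komori_variety I J A"
  shows "mv_ideal A (mv_K n A) \<and> mv_K n A = mv_Rad A"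
proof -
  interpret mv_algebra A by (rule in_komori_variety_mv_algebra[OF assms(3)])
  let ?t = "mv_threshold n A"
  have K: "mv_K n A = {x \<in> carrier A. ?t x = \<zero>\<^bsub>A\<^esub>}"
    by (simp add: mv_K_def mv_threshold_def)
  have ideal: "mv_ideal A (mv_K n A)"
    unfolding mv_ideal_def
  proof (intro conjI ballI impI)
    show "mv_K n A \<subseteq> carrier A" by (auto simp: K)
    show "\<zero>\<^bsub>A\<^esub> \<in> mv_K n A" by (simp add: K threshold_zero)
  next
    fix x y assume x: "x \<in> carrier A" and "y \<in> mv_K n A" and le: "x \<preceq>\<^bsub>A\<^esub> y"
    then have y: "y \<in> carrier A" "?t y = \<zero>\<^bsub>A\<^esub>" by (simp_all add: K)
    define d where "d = \<sim>\<^bsub>A\<^esub> (\<sim>\<^bsub>A\<^esub> y \<oplus>\<^bsub>A\<^esub> x)"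
    have d: "d \<in> carrier A" using x y by (simp add: d_def)
    have "y = x \<oplus>\<^bsub>A\<^esub> d" using le_imp_eq_plus[OF x y(1) le] by (simp add: d_def)
    then have "?t x \<oplus>\<^bsub>A\<^esub> ?t d = \<zero>\<^bsub>A\<^esub>"
      using komori_threshold_plus[OF assms x d] y by simp
    then have "?t x = \<zero>\<^bsub>A\<^esub>" using plus_eq_zeroD x d by blast
    then show "x \<in> mv_K n A" using x by (simp add: K)
  next
    fix x y assume "x \<in> mv_K n A" "y \<in> mv_K n A"
    then show "x \<oplus>\<^bsub>A\<^esub> y \<in> mv_K n A"
      using komori_threshold_plus[OF assms, of x y] by (simp add: K plus_zero)
  qed
  moreover have "mv_K n A \<subseteq> mv_Rad A"
  proof
    fix x assume "x \<in> mv_K n A"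
    then have x: "x \<in> carrier A" "?t x = \<zero>\<^bsub>A\<^esub>" by (simp_all add: K)
    have "mv_nmul A k x \<preceq>\<^bsub>A\<^esub> \<sim>\<^bsub>A\<^esub> x" for k
      using komori_nmul_le_neg_or_threshold[OF assms x(1), of k] x
      by (simp add: mv_le_def plus_zero)
    then show "x \<in> mv_Rad A" using x by (auto simp: mv_Rad_def mv_infinitesimal_def)
  qed
  moreover have "mv_Rad A \<subseteq> mv_K n A"
  proof
    fix x assume "x \<in> mv_Rad A"
    then consider "x = \<zero>\<^bsub>A\<^esub>" | "mv_infinitesimal A x" by (auto simp: mv_Rad_def)
    then show "x \<in> mv_K n A"
    proof cases
      case 1
      then show ?thesis by (simp add: K threshold_zero)
    next
      case 2
      then have x: "x \<in> carrier A" and "mv_nmul A (n + 1) x \<preceq>\<^bsub>A\<^esub> \<sim>\<^bsub>A\<^esub> x"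
        unfolding mv_infinitesimal_def by blast+
      then have "mv_nmul A (n + 1) x \<odot>\<^bsub>A\<^esub> x = \<zero>\<^bsub>A\<^esub>"
        by (simp add: mv_mult_def mv_le_def neg_one del: mv_nmul.simps)
      then have "?t x = \<zero>\<^bsub>A\<^esub>"
        using komori_threshold_plus_nmul[OF assms x] x
        by (simp add: nmul_zero plus_zero del: mv_nmul.simps)
      then show ?thesis using x by (simp add: K)
    qed
  qed
  ultimately show ?thesis by blast
qed

end
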